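(* Let $k\ge1$ and $n>k$ be integers. Then $$\mathrm{iidLP}^{\mathsf{DP}/\mathsf{ExAnte}}_{k,n}=\sup_{\tau\in(0,1]}\mathrm{iidLP}^{\mathsf{OST}(\tau)/\mathsf{Proph}}_{k,n}=\sup_{\tau\in(0,1]}\mathrm{iidLP}^{\mathsf{OST}(\tau)/\mathsf{ExAnte}}_{k,n}=\frac{\mathbb E[\min\{\mathrm{Bin}(n,k/n),k\}]}{k}.$$
   Context: $[n]=\{1,\dots,n\}$; $\mathrm{Bin}(n,q)$ is a Binomial random variable with $n$ trials and success probability $q$. $\mathcal P^k_n$ is the set of pairs $(\mathbf x,\mathbf y)$ of real arrays $\mathbf x=(x^l_i)_{i\in[n],l\in[k]}$, $\mathbf y=(y^l_i)_{i\in[n],l\in[k]}$ such that $0\le y^l_i\le x^l_i$ for all $i,l$; $x^k_1=1$; $x^l_1=0$ for $l<k$; and $x^l_i=x^l_{i-1}-y^l_{i-1}+y^{l+1}_{i-1}$ for all $i>1$, $l\in[k]$, with the convention $y^{k+1}_{i}=0$. Put $Q(q)=\mathbb E[\min\{\mathrm{Bin}(n,q),k\}]$ in problems with superscript "$/\mathsf{Proph}$" and $Q(q)=\min\{nq,k\}$ in those with superscript "$/\mathsf{ExAnte}$". $\mathrm{iidLP}^{\mathsf{DP}/\cdot}_{k,n}$ is the optimal value of: maximize $\theta$ over real $\theta$ and $(\mathbf x,\mathbf y)\in\mathcal P^k_n$ subject to $\theta\cdot Q(q)\le\sum_{i=1}^n\sum_{l=1}^k\min\{y^l_i,qx^l_i\}$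 for all $q\in(0,1]$. For $\tau\in(0,1]$, $\mathrm{iidLP}^{\mathsf{OST}(\tau)/\cdot}_{k,n}$ is the optimal value of the same problem with the additional constraints $y^l_i=\tau x^l_i$ for all $i\in[n],l\in[k]$. *)

theory Defs
  imports "HOL-Probability.Probability"
begin

text \<open>
  An array \<open>x\<^sup>l\<^sub>i\<close> with level \<open>l \<in> {1..k}\<close> and time \<open>i \<in> {1..n}\<close> is a function applied as \<open>x l i\<close>;
  its values outside this range are never constrained or used.
\<close>

type_synonym arr = "nat \<Rightarrow> nat \<Rightarrow> real"

text \<open>
  The conditional encodes the convention that \<open>y\<close> vanishes at level \<open>k + 1\<close>.
\<close>

definition dp_polytope :: "nat \<Rightarrow> nat \<Rightarrow> (arr \<times> arr) set" where
  "dp_polytope k n = {(x, y).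
     (\<forall>i\<in>{1..n}. \<forall>l\<in>{1..k}. 0 \<le> y l i \<and> y l i \<le> x l i) \<and>
     x k 1 = 1 \<and>
     (\<forall>l\<in>{1..k}. l < k \<longrightarrow> x l 1 = 0) \<and>
     (\<forall>i\<in>{1..n}. i > 1 \<longrightarrow> (\<forall>l\<in>{1..k}.
        x l i = x l (i - 1) - y l (i - 1) + (if l = k then 0 else y (l + 1) (i - 1))))}"

definition expected_min_binomial :: "nat \<Rightarrow> nat \<Rightarrow> real \<Rightarrow> real" where
  "expected_min_binomial k n q =
     measure_pmf.expectation (binomial_pmf n q) (\<lambda>j. real (min j k))"

datatype benchmark = Proph | ExAnte

fun benchmark_value :: "benchmark \<Rightarrow> nat \<Rightarrow> nat \<Rightarrow> real \<Rightarrow> real" where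
  "benchmark_value Proph k n q = expected_min_binomial k n q"
| "benchmark_value ExAnte k n q = min (real n * q) (real k)"

definition lp_constraint ::
    "benchmark \<Rightarrow> nat \<Rightarrow> nat \<Rightarrow> real \<Rightarrow> arr \<Rightarrow> arr \<Rightarrow> bool" where
  "lp_constraint b k n \<theta> x y \<longleftrightarrow>
     (\<forall>q\<in>{0<..1}. \<theta> * benchmark_value b k n q \<le> (\<Sum>i=1..n. \<Sum>l=1..k. min (y l i) (q * x l i)))"

text \<open>
  Optimal values are suprema in the extended reals, so that an infeasible problem would have value
  \<open>-\<infinity>\<close> and an unbounded one \<open>\<infinity>\<close>.
\<close>

definition iidLP_DP :: "benchmark \<Rightarrow> nat \<Rightarrow> nat \<Rightarrow> ereal" where
  "iidLP_DP b k n = Sup {ereal \<theta> | \<theta> x y.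
     (x, y) \<in> dp_polytope k n \<and> lp_constraint b k n \<theta> x y}"

definition iidLP_OST :: "real \<Rightarrow> benchmark \<Rightarrow> nat \<Rightarrow> nat \<Rightarrow> ereal" where
  "iidLP_OST \<tau> b k n = Sup {ereal \<theta> | \<theta> x y.
     (x, y) \<in> dp_polytope k n \<and> lp_constraint b k n \<theta> x y \<and>
     (\<forall>i\<in>{1..n}. \<forall>l\<in>{1..k}. y l i = \<tau> * x l i)}"

end

theory Submission imports Defs begin

text \<open>
  Let \<open>M l m q = \<E>[min (Bin(m,q)) l]\<close>. The numbers \<open>M l (n - i + 1) q\<close> are the values, with \<open>l\<close> units
  left at time \<open>i\<close>, of the control problem whose reward is \<open>min {y, q x}\<close>, and, since the increments
  of \<open>M\<close> in \<open>l\<close> lie in \<open>[0,1]\<close>, selling with probability exactly \<open>q\<close> is optimal. Used as a potential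
  they telescope to an upper bound \<open>M k n q\<close> on the right-hand side of the constraint at \<open>q\<close>, with
  equality for \<open>y = q x\<close>. The constraint at \<open>q = k/n\<close> thus bounds every \<open>\<theta>\<close> by \<open>M k n (k/n) / k\<close>,
  and \<open>\<tau> = k/n\<close> attains this bound. For static thresholds the prophet constraints at \<open>q \<rightarrow> 0\<close> and
  \<open>q = 1\<close> already imply the ex-ante ones.
\<close>

section \<open>The truncated binomial mean: recursion and bounds\<close>

lemma expected_min_binomial_0 [simp]: "0 \<le> q \<Longrightarrow> q \<le> 1 \<Longrightarrow> expected_min_binomial k 0 q = 0"
  by (simp add: expected_min_binomial_def binomial_pmf_0)

lemma expected_min_binomial_0_left [simp]: "expected_min_binomial 0 n q = 0"
  by (simp add: expected_min_binomial_def)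

text \<open>Condition on one of the trials: a success counts one and uses up one unit of the cap, a
  failure leaves the cap as it is. This is also the dynamic programming recursion for selling with
  probability \<open>q\<close>.\<close>

lemma expected_min_binomial_Suc:
  assumes "0 \<le> q" "q \<le> 1"
  shows "expected_min_binomial (Suc l) (Suc m) q =
    q * (1 + expected_min_binomial l m q) + (1 - q) * expected_min_binomial (Suc l) m q"
proof -
  have q: "q \<in> {0..1}" using assms by simp
  then have fin: "finite (set_pmf (binomial_pmf m q))"
    by (rule finite_set_pmf_binomial_pmf)
  have int: "integrable (measure_pmf (binomial_pmf m q)) f" for f :: "nat \<Rightarrow> real"
    by (rule integrable_measure_pmf_finite[OF fin])
  have Suc_shift: "real (min (Suc j) (Suc l)) = 1 + real (min j l)" for j
    by simp
  have "binomial_pmf (Suc m) q =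
      bernoulli_pmf q \<bind> (\<lambda>b. map_pmf (\<lambda>j. (if b then 1 else 0) + j) (binomial_pmf m q))"
    by (simp add: binomial_pmf_Suc[OF q] map_pmf_def)
  then have "expected_min_binomial (Suc l) (Suc m) q =
     (\<Sum>b\<in>UNIV. pmf (bernoulli_pmf q) b *\<^sub>R measure_pmf.expectation
       (map_pmf (\<lambda>j. (if b then 1 else 0) + j) (binomial_pmf m q)) (\<lambda>j. real (min j (Suc l))))"
    unfolding expected_min_binomial_def by (simp only:) (rule pmf_expectation_bind, use fin in auto)
  also have "\<dots> = q * measure_pmf.expectation (binomial_pmf m q) (\<lambda>j. 1 + real (min j l)) +
      (1 - q) * expected_min_binomial (Suc l) m q"
    using assms by (simp add: UNIV_bool Suc_shift expected_min_binomial_def del: min_Suc_Suc of_nat_min)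
  also have "measure_pmf.expectation (binomial_pmf m q) (\<lambda>j. 1 + real (min j l)) =
      1 + expected_min_binomial l m q"
    unfolding expected_min_binomial_def by (subst Bochner_Integration.integral_add) (use int in auto)
  finally show ?thesis .
qed

lemma expected_min_binomial_nonneg: "0 \<le> expected_min_binomial l m q"
  by (simp add: expected_min_binomial_def)

text \<open>By the recursion, an increment in the cap at \<open>Suc m\<close> is a convex
  combination of increments at \<open>m\<close>; at cap 0 the number 1 takes the place of the
  missing lower increment. The increment is the marginal value of one more unit and later serves as
  a convex weight.\<close>

lemma expected_min_binomial_increment:
  assumes q: "0 \<le> q" "q \<le> 1"
  shows "0 \<le> expected_min_binomial (Suc l) m q - expected_min_binomial l m q \<and>
    expected_min_binomial (Suc l) m q - expected_min_binomial l m q \<le> 1"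
proof (induction m arbitrary: l)
  case (Suc m)
  let ?d = "\<lambda>l. expected_min_binomial (Suc l) m q - expected_min_binomial l m q"
  show ?case
  proof (cases l)
    case 0
    have "expected_min_binomial (Suc l) (Suc m) q - expected_min_binomial l (Suc m) q
        = q * 1 + (1 - q) * ?d 0"
      using 0 by (simp add: expected_min_binomial_Suc[OF q])
    moreover have "q * 1 + (1 - q) * ?d 0 \<le> 1"
      using Suc.IH[of 0] q by (intro convex_bound_le) auto
    ultimately show ?thesis
      using Suc.IH[of 0] q by simp
  next
    case (Suc l')
    have "expected_min_binomial (Suc l) (Suc m) q - expected_min_binomial l (Suc m) q
        = q * ?d l' + (1 - q) * ?d l"
      using Suc by (simp add: expected_min_binomial_Suc[OF q] algebra_simps)
    moreover have "q * ?d l' + (1 - q) * ?d l \<le> 1"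
      using Suc.IH[of l'] Suc.IH[of l] q by (intro convex_bound_le) auto
    moreover have "0 \<le> q * ?d l' + (1 - q) * ?d l"
      using Suc.IH[of l'] Suc.IH[of l] q by (intro add_nonneg_nonneg mult_nonneg_nonneg) auto
    ultimately show ?thesis by simp
  qed
qed (simp add: q)

lemma expected_min_binomial_le_mean:
  assumes q: "0 \<le> q" "q \<le> 1"
  shows "expected_min_binomial l m q \<le> real m * q"
proof (induction m arbitrary: l)
  case (Suc m)
  show ?case
  proof (cases l)
    case 0
    then show ?thesis using q by simp
  next
    case (Suc l')
    have "q * expected_min_binomial l' m q + (1 - q) * expected_min_binomial l m q \<le> real m * q"
      using Suc.IH[of l'] Suc.IH[of l] q by (intro convex_bound_le) auto
    then show ?thesis
      using Suc by (simp add: expected_min_binomial_Suc[OF q] algebra_simps)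
  qed
qed (simp add: q)

lemma expected_min_binomial_le:
  assumes "0 \<le> q" "q \<le> 1"
  shows "expected_min_binomial l m q \<le> real l"
proof (induction l)
  case (Suc l)
  then show ?case
    using expected_min_binomial_increment[OF assms, of l m] by simp
qed simp

text \<open>Together with the upper bound by the mean, this gives slope \<open>m\<close> at
  \<open>q = 0\<close>. The induction goes through even after dropping the nonnegative value that
  remains after a success.\<close>

lemma expected_min_binomial_ge:
  assumes q: "0 \<le> q" "q \<le> 1" and "l \<ge> 1"
  shows "real m * q - (real m * q)\<^sup>2 \<le> expected_min_binomial l m q"
proof (induction m)
  case (Suc m)
  obtain l' where l: "l = Suc l'" using \<open>l \<ge> 1\<close> by (cases l) auto
  have "(real (Suc m) * q - (real (Suc m) * q)\<^sup>2) =
      q + (1 - q) * (real m * q - (real m * q)\<^sup>2) - (q\<^sup>2 + real m * q\<^sup>2 + (real m)\<^sup>2 * q ^ 3)"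
    by (simp add: algebra_simps power2_eq_square power3_eq_cube)
  also have "\<dots> \<le> q + (1 - q) * (real m * q - (real m * q)\<^sup>2)"
    using zero_le_power2[of q] q by (simp only: diff_le_eq le_add_same_cancel1, intro add_nonneg_nonneg mult_nonneg_nonneg) auto
  also have "\<dots> \<le> q + (1 - q) * expected_min_binomial l m q"
    using Suc.IH q by (intro add_left_mono mult_left_mono) auto
  also have "\<dots> \<le> expected_min_binomial l (Suc m) q"
    using q expected_min_binomial_nonneg[of l' m q] by (simp add: l expected_min_binomial_Suc distrib_left)
  finally show ?case .
qed (simp add: q)

lemma expected_min_binomial_1: "n \<ge> k \<Longrightarrow> expected_min_binomial k n 1 = real k"
proof (induction n arbitrary: k)
  case (Suc n)
  then show ?case by (cases k) (auto simp: expected_min_binomial_Suc)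
qed simp

section \<open>The potential argument on the polytope\<close>

lemma dp_polytope_nonneg:
  assumes "(x, y) \<in> dp_polytope k n" "i \<in> {1..n}" "l \<in> {1..k}"
  shows "0 \<le> x l i"
proof -
  have "0 \<le> y l i \<and> y l i \<le> x l i"
    using assms unfolding dp_polytope_def by blast
  then show ?thesis by linarith
qed

text \<open>The inner sum is the drop of the potential \<open>\<Phi>\<close> during period
  \<open>i\<close>. Without a sale, one period less costs
  \<open>?V l (Suc m) - ?V l m = q * (1 - d)\<close>; the mass \<open>y\<close> that sells moves
  down one level and loses the marginal value \<open>d\<close>. The identity holds for every point
  of the polytope.\<close>

lemma dp_polytope_telescope:
  assumes xy: "(x, y) \<in> dp_polytope k n" and "k \<ge> 1" "n \<ge> 1" and q: "0 \<le> q" "q \<le> 1"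
  defines "d \<equiv> \<lambda>l i. expected_min_binomial l (n - i) q - expected_min_binomial (l - 1) (n - i) q"
  shows "(\<Sum>i=1..n. \<Sum>l=1..k. q * x l i * (1 - d l i) + y l i * d l i) = expected_min_binomial k n q"
proof -
  let ?V = "\<lambda>l m. expected_min_binomial l m q"
  define \<Phi> where "\<Phi> i = (\<Sum>l=1..k. x l i * ?V l (Suc n - i))" for i
  have step: "(\<Sum>l=1..k. q * x l i * (1 - d l i) + y l i * d l i) = \<Phi> i - \<Phi> (Suc i)"
    if i: "i \<in> {1..n}" for i
  proof -
    have next_x: "x l (Suc i) * ?V l (n - i) =
        (x l i - y l i) * ?V l (n - i) + (if l = k then 0 else y (l + 1) i * ?V l (n - i))"
      if l: "l \<in> {1..k}" for l
    \<comment> \<open>At \<open>i = n\<close> the entry \<open>x l (Suc n)\<close> is unconstrained,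
      but it is multiplied by \<open>?V l 0 = 0\<close>, as is everything on the right.\<close>
    proof (cases "i = n")
      case False
      then have "x l (Suc i) = x l i - y l i + (if l = k then 0 else y (l + 1) i)"
        using xy i l by (auto simp: dp_polytope_def dest!: bspec[where x = "Suc i"])
      then show ?thesis by (simp add: ring_distribs)
    qed (simp add: q)
    have "(\<Sum>l=1..k. if l = k then 0 else y (l + 1) i * ?V l (n - i)) =
        (\<Sum>l\<in>{1..<k}. y (Suc l) i * ?V l (n - i))"
      by (rule sum.mono_neutral_cong_right) auto
    \<comment> \<open>The added term at level 0 vanishes because nothing can be sold from an empty
      stock.\<close>
    also have "\<dots> = (\<Sum>l\<in>{0..<k}. y (Suc l) i * ?V l (n - i))"
      by (rule sum.mono_neutral_left) (auto simp: not_less_eq_eq)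
    also have "\<dots> = (\<Sum>l\<in>{Suc 0..<Suc k}. y l i * ?V (l - 1) (n - i))"
      by (subst sum.shift_bounds_Suc_ivl) simp
    finally have shift: "(\<Sum>l=1..k. if l = k then 0 else y (l + 1) i * ?V l (n - i)) =
        (\<Sum>l=1..k. y l i * ?V (l - 1) (n - i))"
      by (simp add: atLeastLessThanSuc_atLeastAtMost)
    have "\<Phi> (Suc i) = (\<Sum>l=1..k. (x l i - y l i) * ?V l (n - i)
        + (if l = k then 0 else y (l + 1) i * ?V l (n - i)))"
      unfolding \<Phi>_def diff_Suc_Suc by (rule sum.cong[OF refl next_x])
    also have "\<dots> = (\<Sum>l=1..k. (x l i - y l i) * ?V l (n - i) + y l i * ?V (l - 1) (n - i))"
      by (simp only: sum.distrib shift)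
    finally have "\<Phi> i - \<Phi> (Suc i) = (\<Sum>l=1..k. x l i * ?V l (Suc n - i)
        - ((x l i - y l i) * ?V l (n - i) + y l i * ?V (l - 1) (n - i)))"
      by (simp only: \<Phi>_def sum_subtractf)
    also have "\<dots> = (\<Sum>l=1..k. q * x l i * (1 - d l i) + y l i * d l i)"
    proof (rule sum.cong[OF refl])
      fix l assume "l \<in> {1..k}"
      then obtain l' where l': "l = Suc l'" by (cases l) auto
      have "Suc n - i = Suc (n - i)" using i by auto
      then show "x l i * ?V l (Suc n - i)
          - ((x l i - y l i) * ?V l (n - i) + y l i * ?V (l - 1) (n - i))
          = q * x l i * (1 - d l i) + y l i * d l i"
        by (simp add: l' d_def expected_min_binomial_Suc[OF q] algebra_simps)
    qed
    finally show ?thesis by simp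
  qed
  have "\<Phi> 1 = (\<Sum>l=1..k. if l = k then ?V k n else 0)"
    unfolding \<Phi>_def using xy by (intro sum.cong) (auto simp: dp_polytope_def)
  also have "\<dots> = ?V k n"
    using \<open>k \<ge> 1\<close> by simp
  finally have "\<Phi> 1 = ?V k n" .
  moreover have "(\<Sum>i=1..n. \<Phi> i - \<Phi> (Suc i)) = \<Phi> 1 - \<Phi> (Suc n)"
    using sum_Suc_diff[of 1 n "\<lambda>i. - \<Phi> i"] \<open>n \<ge> 1\<close> by simp
  moreover have "\<Phi> (Suc n) = 0"
    by (simp add: \<Phi>_def q)
  moreover have "(\<Sum>i=1..n. \<Sum>l=1..k. q * x l i * (1 - d l i) + y l i * d l i) =
      (\<Sum>i=1..n. \<Phi> i - \<Phi> (Suc i))"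
    by (rule sum.cong[OF refl step])
  ultimately show ?thesis by simp
qed

section \<open>Reward bounds and static policies\<close>

lemma dp_polytope_reward_le:
  assumes xy: "(x, y) \<in> dp_polytope k n" and "k \<ge> 1" "n \<ge> 1" and q: "0 \<le> q" "q \<le> 1"
  shows "(\<Sum>i=1..n. \<Sum>l=1..k. min (y l i) (q * x l i)) \<le> expected_min_binomial k n q"
proof -
  define d where
    "d l i = expected_min_binomial l (n - i) q - expected_min_binomial (l - 1) (n - i) q" for l i
  have "min (y l i) (q * x l i) \<le> q * x l i * (1 - d l i) + y l i * d l i"
    if "l \<in> {1..k}" for l i
  proof -
    have d: "0 \<le> d l i" "d l i \<le> 1"
      using expected_min_binomial_increment[OF q, of "l - 1" "n - i"] that by (auto simp: d_def)
    \<comment> \<open>A minimum is at most any convex combination of its arguments; the weights are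
      \<open>1 - d\<close> and \<open>d\<close>.\<close>
    have "min (y l i) (q * x l i) =
        min (y l i) (q * x l i) * (1 - d l i) + min (y l i) (q * x l i) * d l i"
      by (simp add: algebra_simps)
    also have "\<dots> \<le> q * x l i * (1 - d l i) + y l i * d l i"
      using d by (intro add_mono mult_right_mono) auto
    finally show ?thesis .
  qed
  then have "(\<Sum>i=1..n. \<Sum>l=1..k. min (y l i) (q * x l i))
      \<le> (\<Sum>i=1..n. \<Sum>l=1..k. q * x l i * (1 - d l i) + y l i * d l i)"
    by (intro sum_mono) auto
  also have "\<dots> = expected_min_binomial k n q"
    unfolding d_def by (rule dp_polytope_telescope[OF assms])
  finally show ?thesis .
qed

lemma dp_polytope_static_reward:
  assumes "(x, \<lambda>l i. \<tau> * x l i) \<in> dp_polytope k n" "k \<ge> 1" "n \<ge> 1" "0 \<le> \<tau>" "\<tau> \<le> 1"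
  shows "\<tau> * (\<Sum>i=1..n. \<Sum>l=1..k. x l i) = expected_min_binomial k n \<tau>"
proof -
  \<comment> \<open>For \<open>y = \<tau> * x\<close> and \<open>q = \<tau>\<close> both arguments
    of the convex combination coincide, so the weights cancel in the telescoping identity.\<close>
  have "\<tau> * X * (1 - D) + \<tau> * X * D = \<tau> * X" for X D :: real
    by (simp add: algebra_simps)
  then show ?thesis
    using dp_polytope_telescope[OF assms] by (simp add: sum_distrib_left)
qed

lemma static_policy_exists:
  assumes "0 \<le> \<tau>" "\<tau> \<le> 1"
  obtains x where "(x, \<lambda>l i. \<tau> * x l i) \<in> dp_polytope k n"
proof -
  \<comment> \<open>The state equation is run forward from full stock. \<open>g\<close> counts
    elapsed periods, so time \<open>i\<close> corresponds to \<open>g (i - 1)\<close>.\<close>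
  define g :: "nat \<Rightarrow> nat \<Rightarrow> real" where "g = rec_nat (\<lambda>l. if l = k then 1 else 0)
     (\<lambda>_ h l. h l - \<tau> * h l + (if l = k then 0 else \<tau> * h (l + 1)))"
  have g_Suc: "g (Suc i) l = g i l - \<tau> * g i l + (if l = k then 0 else \<tau> * g i (l + 1))" for i l
    by (simp add: g_def)
  have nonneg: "0 \<le> g i l" for i l
  proof (induction i arbitrary: l)
    case (Suc i)
    have "0 \<le> (1 - \<tau>) * g i l + (if l = k then 0 else \<tau> * g i (l + 1))"
      using Suc assms by simp
    then show ?case by (simp add: g_Suc algebra_simps split: if_splits)
  qed (simp add: g_def)
  have "((\<lambda>l i. g (i - 1) l), \<lambda>l i. \<tau> * g (i - 1) l) \<in> dp_polytope k n"
    unfolding dp_polytope_def mem_Collect_eq case_prod_conv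
  proof (intro conjI ballI impI)
    fix i l
    show "0 \<le> \<tau> * g (i - 1) l" "\<tau> * g (i - 1) l \<le> g (i - 1) l"
      using nonneg[of "i - 1" l] assms by (simp_all add: mult_left_le_one_le)
  next
    fix i l :: nat assume "i > 1"
    then have "i - 1 = Suc (i - 1 - 1)" by simp
    then show "g (i - 1) l = g (i - 1 - 1) l - \<tau> * g (i - 1 - 1) l +
        (if l = k then 0 else \<tau> * g (i - 1 - 1) (l + 1))"
      by (metis g_Suc)
  qed (auto simp: g_def)
  then show thesis by (rule that)
qed

text \<open>Nonnegativity of \<open>x\<close> lets \<open>min \<tau> q\<close> factor out of every
  summand, so the arrays enter only through one number, the total of \<open>x\<close>.\<close>

lemma lp_constraint_static_iff:
  assumes "\<forall>i\<in>{1..n}. \<forall>l\<in>{1..k}. y l i = \<tau> * x l i \<and> 0 \<le> x l i"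
  shows "lp_constraint b k n \<theta> x y \<longleftrightarrow>
    (\<forall>q\<in>{0<..1}. \<theta> * benchmark_value b k n q \<le> min \<tau> q * (\<Sum>i=1..n. \<Sum>l=1..k. x l i))"
proof -
  have "(\<Sum>i=1..n. \<Sum>l=1..k. min (y l i) (q * x l i)) = min \<tau> q * (\<Sum>i=1..n. \<Sum>l=1..k. x l i)" for q
    unfolding sum_distrib_left
    using assms by (intro sum.cong) (auto simp: min_mult_distrib_right)
  then show ?thesis by (simp add: lp_constraint_def)
qed

lemma benchmark_value_Proph_le_ExAnte:
  assumes "0 \<le> q" "q \<le> 1"
  shows "benchmark_value Proph k n q \<le> benchmark_value ExAnte k n q"
  using expected_min_binomial_le_mean[OF assms] expected_min_binomial_le[OF assms] by simp

text \<open>Both sides of the ex-ante constraint are controlled by two pieces: up to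
  \<open>\<tau>\<close> it suffices that \<open>\<theta> * n \<le> S\<close>, and beyond
  \<open>\<tau>\<close> that \<open>\<theta> * k \<le> \<tau> * S\<close>. The prophet constraints
  yield the first from their slope at 0 and the second at \<open>q = 1\<close>.\<close>

lemma static_constraint_Proph_iff_ExAnte:
  assumes "k \<ge> 1" "n \<ge> k" "0 < \<tau>" "\<tau> \<le> 1" "0 \<le> \<theta>"
  shows "(\<forall>q\<in>{0<..1}. \<theta> * benchmark_value Proph k n q \<le> min \<tau> q * S) \<longleftrightarrow>
    (\<forall>q\<in>{0<..1}. \<theta> * benchmark_value ExAnte k n q \<le> min \<tau> q * S)" (is "?P \<longleftrightarrow> ?E")
proof
  assume ?E
  then show ?P
    using mult_left_mono[OF benchmark_value_Proph_le_ExAnte \<open>0 \<le> \<theta>\<close>]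
    by (meson greaterThanAtMost_iff less_imp_le order_trans)
next
  assume P: ?P
  have at_1: "\<theta> * real k \<le> \<tau> * S"
    using bspec[OF P, of 1] assms by (simp add: expected_min_binomial_1)
  \<comment> \<open>The prophet constraint with its quadratic lower bound, divided by
    \<open>q\<close>; the limit \<open>q \<rightarrow> 0\<close> then removes the error
    term.\<close>
  have small: "\<theta> * (real n - (real n)\<^sup>2 * q) \<le> S" if q: "0 < q" "q \<le> \<tau>" for q
  proof -
    have "q * (\<theta> * (real n - (real n)\<^sup>2 * q)) = \<theta> * (real n * q - (real n * q)\<^sup>2)"
      by (simp add: algebra_simps power2_eq_square)
    also have "\<dots> \<le> \<theta> * benchmark_value Proph k n q"
      using q assms expected_min_binomial_ge[of q k n] by (simp add: mult_left_mono)
    also have "\<dots> \<le> q * S"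
      using bspec[OF P, of q] q assms by (simp add: min_def split: if_splits)
    finally show ?thesis using q by simp
  qed
  have at_0: "\<theta> * real n \<le> S"
  proof (rule tendsto_upperbound)
    have "((\<lambda>q. \<theta> * (real n - (real n)\<^sup>2 * q)) \<longlongrightarrow> \<theta> * (real n - (real n)\<^sup>2 * 0)) (at_right 0)"
      by (intro tendsto_intros)
    then show "((\<lambda>q. \<theta> * (real n - (real n)\<^sup>2 * q)) \<longlongrightarrow> \<theta> * real n) (at_right 0)" by simp
    show "\<forall>\<^sub>F q in at_right 0. \<theta> * (real n - (real n)\<^sup>2 * q) \<le> S"
      using small \<open>0 < \<tau>\<close> by (auto simp: eventually_at_right_field intro!: exI[of _ \<tau>])
  qed simp
  show ?E
  proof
    fix q :: real assume "q \<in> {0<..1}"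
    show "\<theta> * benchmark_value ExAnte k n q \<le> min \<tau> q * S"
    proof (cases "q \<le> \<tau>")
      case True
      have "\<theta> * benchmark_value ExAnte k n q \<le> \<theta> * (real n * q)"
        using \<open>0 \<le> \<theta>\<close> by (intro mult_left_mono) auto
      also have "\<dots> \<le> q * S"
        using at_0 \<open>q \<in> _\<close> mult_left_mono[of "\<theta> * real n" S q] by (simp add: mult_ac)
      finally show ?thesis using True by (simp add: min_absorb2)
    next
      case False
      have "\<theta> * benchmark_value ExAnte k n q \<le> \<theta> * real k"
        using \<open>0 \<le> \<theta>\<close> by (intro mult_left_mono) auto
      then show ?thesis using at_1 False by simp
    qed
  qed
qed

section \<open>Comparison of the optimal values\<close>

lemma iidLP_OST_Proph_le_ExAnte:
  assumes "k \<ge> 1" "n \<ge> k" "0 < \<tau>" "\<tau> \<le> 1"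
  shows "iidLP_OST \<tau> Proph k n \<le> iidLP_OST \<tau> ExAnte k n"
  unfolding iidLP_OST_def
proof (rule Sup_least, clarify)
  fix \<theta> x y
  assume xy: "(x, y) \<in> dp_polytope k n" and c: "lp_constraint Proph k n \<theta> x y"
    and y: "\<forall>i\<in>{1..n}. \<forall>l\<in>{1..k}. y l i = \<tau> * x l i"
  have st: "\<forall>i\<in>{1..n}. \<forall>l\<in>{1..k}. y l i = \<tau> * x l i \<and> 0 \<le> x l i"
    using y dp_polytope_nonneg[OF xy] by blast
  have S: "0 \<le> (\<Sum>i=1..n. \<Sum>l=1..k. x l i)"
    using st by (intro sum_nonneg) auto
  \<comment> \<open>The equivalence of the constraints needs a nonnegative factor. Replacing a
    negative \<open>\<theta>\<close> by 0 keeps the prophet constraints, since the total of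
    \<open>x\<close> is nonnegative, and only raises the objective.\<close>
  have "lp_constraint ExAnte k n (max \<theta> 0) x y"
  proof -
    have "\<forall>q\<in>{0<..1}. max \<theta> 0 * benchmark_value Proph k n q \<le> min \<tau> q * (\<Sum>i=1..n. \<Sum>l=1..k. x l i)"
      using c S \<open>0 < \<tau>\<close> unfolding lp_constraint_static_iff[OF st] by (auto simp: max_def)
    then show ?thesis
      unfolding lp_constraint_static_iff[OF st]
      using static_constraint_Proph_iff_ExAnte[OF assms, of "max \<theta> 0"] by simp
  qed
  then have "ereal (max \<theta> 0) \<le> Sup {ereal \<theta> |\<theta> x y. (x, y) \<in> dp_polytope k n \<and>
      lp_constraint ExAnte k n \<theta> x y \<and> (\<forall>i\<in>{1..n}. \<forall>l\<in>{1..k}. y l i = \<tau> * x l i)}"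
    using xy y by (intro Sup_upper) blast
  then show "ereal \<theta> \<le> Sup {ereal \<theta> |\<theta> x y. (x, y) \<in> dp_polytope k n \<and>
      lp_constraint ExAnte k n \<theta> x y \<and> (\<forall>i\<in>{1..n}. \<forall>l\<in>{1..k}. y l i = \<tau> * x l i)}"
    by (rule order.trans[rotated]) simp
qed

lemma iidLP_OST_le_DP: "iidLP_OST \<tau> b k n \<le> iidLP_DP b k n"
  unfolding iidLP_OST_def iidLP_DP_def by (rule Sup_subset_mono) auto

lemma iidLP_DP_ExAnte_le:
  assumes "k \<ge> 1" "n \<ge> k"
  shows "iidLP_DP ExAnte k n \<le> ereal (expected_min_binomial k n (real k / real n) / real k)"
  unfolding iidLP_DP_def
proof (rule Sup_least, clarify)
  fix \<theta> x y
  assume xy: "(x, y) \<in> dp_polytope k n" and c: "lp_constraint ExAnte k n \<theta> x y"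
  \<comment> \<open>The kink of the ex-ante benchmark, where \<open>n * q\<close> and
    \<open>k\<close> agree.\<close>
  let ?q = "real k / real n"
  have q: "0 < ?q" "?q \<le> 1" using assms by auto
  have "\<theta> * benchmark_value ExAnte k n ?q \<le> (\<Sum>i=1..n. \<Sum>l=1..k. min (y l i) (?q * x l i))"
    using c q unfolding lp_constraint_def by (meson greaterThanAtMost_iff)
  also have "\<dots> \<le> expected_min_binomial k n ?q"
    using xy assms q by (intro dp_polytope_reward_le) auto
  finally have "\<theta> * real k \<le> expected_min_binomial k n ?q"
    using assms by simp
  then show "ereal \<theta> \<le> ereal (expected_min_binomial k n ?q / real k)"
    using assms by (simp add: pos_le_divide_eq)
qed

lemma iidLP_OST_Proph_ge:
  assumes "k \<ge> 1" "n \<ge> k"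
  shows "ereal (expected_min_binomial k n (real k / real n) / real k)
    \<le> iidLP_OST (real k / real n) Proph k n"
proof -
  define \<tau> where "\<tau> = real k / real n"
  have \<tau>: "0 < \<tau>" "\<tau> \<le> 1" using assms by (auto simp: \<tau>_def)
  obtain x where x: "(x, \<lambda>l i. \<tau> * x l i) \<in> dp_polytope k n"
    using static_policy_exists[of \<tau>] \<tau> by (meson less_imp_le)
  define S where "S = (\<Sum>i=1..n. \<Sum>l=1..k. x l i)"
  define \<theta> where "\<theta> = expected_min_binomial k n \<tau> / real k"
  have "\<tau> * S = expected_min_binomial k n \<tau>"
    unfolding S_def using x assms \<tau> by (intro dp_polytope_static_reward) auto
  then have \<theta>: "\<theta> = S / real n"
    using assms by (simp add: \<theta>_def \<tau>_def field_simps)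
  have "0 \<le> \<theta>"
    by (simp add: \<theta>_def expected_min_binomial_nonneg)
  have "\<theta> * benchmark_value ExAnte k n q \<le> min \<tau> q * S" for q
  proof -
    \<comment> \<open>Because \<open>\<tau>\<close> sits at the kink, the static reward is
      proportional to the ex-ante benchmark: all ex-ante constraints hold with equality for this
      \<open>\<theta>\<close>.\<close>
    have "real n * min \<tau> q = min (real n * q) (real k)"
      using assms by (simp add: min_mult_distrib_left \<tau>_def min.commute)
    then have "min \<tau> q * S = \<theta> * benchmark_value ExAnte k n q"
      using assms by (simp add: \<theta> field_simps)
    then show ?thesis by simp
  qed
  then have c: "\<forall>q\<in>{0<..1}. \<theta> * benchmark_value Proph k n q \<le> min \<tau> q * S"
    using static_constraint_Proph_iff_ExAnte[OF assms \<tau> \<open>0 \<le> \<theta>\<close>] by blast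
  have "\<forall>i\<in>{1..n}. \<forall>l\<in>{1..k}. \<tau> * x l i = \<tau> * x l i \<and> 0 \<le> x l i"
    using dp_polytope_nonneg[OF x] by blast
  from lp_constraint_static_iff[OF this] c
  have "lp_constraint Proph k n \<theta> x (\<lambda>l i. \<tau> * x l i)"
    unfolding S_def by blast
  then have "ereal \<theta> \<le> iidLP_OST \<tau> Proph k n"
    unfolding iidLP_OST_def using x by (intro Sup_upper) auto
  then show ?thesis by (simp add: \<theta>_def \<tau>_def)
qed

theorem theorem8:
  fixes k n :: nat
  assumes "k \<ge> 1" and "n > k"
  shows "iidLP_DP ExAnte k n = (SUP \<tau>\<in>{0<..1}. iidLP_OST \<tau> Proph k n)
       \<and> (SUP \<tau>\<in>{0<..1}. iidLP_OST \<tau> Proph k n) = (SUP \<tau>\<in>{0<..1}. iidLP_OST \<tau> ExAnte k n)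
       \<and> (SUP \<tau>\<in>{0<..1}. iidLP_OST \<tau> ExAnte k n)
           = ereal (expected_min_binomial k n (real k / real n) / real k)"
proof -
  let ?v = "ereal (expected_min_binomial k n (real k / real n) / real k)"
  let ?P = "SUP \<tau>\<in>{0<..1}. iidLP_OST \<tau> Proph k n" and ?E = "SUP \<tau>\<in>{0<..1}. iidLP_OST \<tau> ExAnte k n"
  have kn: "k \<ge> 1" "n \<ge> k" using assms by auto
  \<comment> \<open>The inequalities close a cycle
    \<open>?v \<le> ?P \<le> ?E \<le> iidLP_DP ExAnte k n \<le> ?v\<close>, which forces equality
    throughout.\<close>
  have "?v \<le> iidLP_OST (real k / real n) Proph k n"
    by (rule iidLP_OST_Proph_ge[OF kn])
  also have "\<dots> \<le> ?P"
    using assms by (intro SUP_upper) auto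
  finally have vP: "?v \<le> ?P" .
  have PE: "?P \<le> ?E"
    using iidLP_OST_Proph_le_ExAnte[OF kn] by (intro SUP_subset_mono) auto
  have ED: "?E \<le> iidLP_DP ExAnte k n"
    by (intro SUP_least iidLP_OST_le_DP)
  have Dv: "iidLP_DP ExAnte k n \<le> ?v"
    by (rule iidLP_DP_ExAnte_le[OF kn])
  show ?thesis
    by (intro conjI order.antisym[OF order.trans[OF Dv vP] order.trans[OF PE ED]]
      order.antisym[OF PE order.trans[OF ED order.trans[OF Dv vP]]]
      order.antisym[OF order.trans[OF ED Dv] order.trans[OF vP PE]])
qed

end
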